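(* Let $H_\nu^N$ be the family of integrals described in the context. Then for all $z>0$, \[ H^{N+2}_\nu(z)=\mp\left(\frac{d^2H_\nu^N(z)}{dz^2}+\frac{1}{z}\frac{d H_\nu^N(z)}{dz}-\frac{\nu^2}{z^2}H_\nu^N(z)\right), \] where the upper sign ($-$) is taken if $C_\nu$ solves the Bessel equation and the lower sign ($+$) if $C_\nu$ solves the modified Bessel equation.
   Context: Let $N\in\mathbb{R}$, $\nu\in\mathbb{C}$, let $-\infty\le t_i<t_f\le\infty$, let $r:(t_i,t_f)\to(0,\infty)$ and $w:(t_i,t_f)\to\mathbb{C}$ be functions, and let $C_\nu, C_{\nu+1}:(0,\infty)\to\mathbb{C}$. Define for $z>0$ (and likewise with other values of $N$ and with $\nu+1$ in place of $\nu$) \[ H_\nu^N(z)=\int_{t_i}^{t_f} r(t)^N\, C_\nu(z\,r(t))\, w(t)\,dt . \] Assumptions: (i) the integrals $H_\nu^N$, $H_\nu^{N+2}$, $H_{\nu+1}^{N+1}$ are defined in the $L^1$ sense (the integrands are absolutely integrable for each $z>0$); (ii) differentiation in $z$ commutes with the integral, i.e. $H_\nu^N$ is twice differentiable on $(0,\infty)$ and its first and second derivatives are given by (absolutely convergent) integrals obtained by differentiating the integrand in $z$; (iii) $C_\nu$ is a solution on $(0,\infty)$ of the Bessel equation (upper sign) or of the modified Bessel equation (lower sign) \[ z^2\frac{d^2C_\nu(z)}{dz^2}+z\frac{dC_\nu(z)}{dz}=(\nu^2\mp z^2)\,C_\nu(z); \] (iv) $\frac{d}{dz}\left[z^{-\nu}C_\nu(z)\right]=-z^{-\nu}C_{\nu+1}(z)$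 for $z>0$. *)

theory Defs
  imports "HOL-Analysis.Analysis"
begin

text \<open>
  All functions of the argument \<open>z\<close> are complex-valued functions of a real variable, so
  \<open>d/dz\<close> is the library's \<^const>\<open>vector_derivative\<close>. The index \<open>\<nu>\<close> of a family \<open>C\<close> is
  complex, and \<open>C \<nu>\<close> is only ever constrained on the positive reals.
\<close>

abbreviation dz :: "(real \<Rightarrow> complex) \<Rightarrow> real \<Rightarrow> complex" where
  "dz f z \<equiv> vector_derivative f (at z)"

definition bessel_equation :: "complex \<Rightarrow> (real \<Rightarrow> complex) \<Rightarrow> bool" where
  "bessel_equation \<nu> f \<longleftrightarrow>
     (\<forall>z>0. f differentiable (at z) \<and> dz f differentiable (at z) \<and>
        (of_real z)\<^sup>2 * dz (dz f) z + of_real z * dz f z = (\<nu>\<^sup>2 - (of_real z)\<^sup>2) * f z)"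

definition modified_bessel_equation :: "complex \<Rightarrow> (real \<Rightarrow> complex) \<Rightarrow> bool" where
  "modified_bessel_equation \<nu> f \<longleftrightarrow>
     (\<forall>z>0. f differentiable (at z) \<and> dz f differentiable (at z) \<and>
        (of_real z)\<^sup>2 * dz (dz f) z + of_real z * dz f z = (\<nu>\<^sup>2 + (of_real z)\<^sup>2) * f z)"

definition H_integrand ::
  "(real \<Rightarrow> real) \<Rightarrow> (real \<Rightarrow> complex) \<Rightarrow> (complex \<Rightarrow> real \<Rightarrow> complex) \<Rightarrow>
     complex \<Rightarrow> real \<Rightarrow> real \<Rightarrow> real \<Rightarrow> complex" where
  "H_integrand r w C \<nu> N z t = of_real (r t powr N) * C \<nu> (z * r t) * w t"

text \<open>
  The end points are extended reals and \<open>einterval ti tf\<close> is the open interval of reals strictly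
  between them. The integral is taken with respect to complete Lebesgue measure, so that no Borel
  measurability is imposed on \<open>r\<close>, \<open>w\<close> or \<open>C\<close>.
\<close>

definition H ::
  "ereal \<Rightarrow> ereal \<Rightarrow> (real \<Rightarrow> real) \<Rightarrow> (real \<Rightarrow> complex) \<Rightarrow> (complex \<Rightarrow> real \<Rightarrow> complex) \<Rightarrow>
     complex \<Rightarrow> real \<Rightarrow> real \<Rightarrow> complex" where
  "H ti tf r w C \<nu> N z = (LINT t:einterval ti tf|lebesgue. H_integrand r w C \<nu> N z t)"

definition H_abs_convergent ::
  "ereal \<Rightarrow> ereal \<Rightarrow> (real \<Rightarrow> real) \<Rightarrow> (real \<Rightarrow> complex) \<Rightarrow> (complex \<Rightarrow> real \<Rightarrow> complex) \<Rightarrow>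
     complex \<Rightarrow> real \<Rightarrow> bool" where
  "H_abs_convergent ti tf r w C \<nu> N \<longleftrightarrow>
     (\<forall>z>0. set_integrable lebesgue (einterval ti tf) (H_integrand r w C \<nu> N z))"

definition H_diff_under_integral ::
  "ereal \<Rightarrow> ereal \<Rightarrow> (real \<Rightarrow> real) \<Rightarrow> (real \<Rightarrow> complex) \<Rightarrow> (complex \<Rightarrow> real \<Rightarrow> complex) \<Rightarrow>
     complex \<Rightarrow> real \<Rightarrow> bool" where
  "H_diff_under_integral ti tf r w C \<nu> N \<longleftrightarrow>
     (\<forall>z>0.
        set_integrable lebesgue (einterval ti tf)
          (\<lambda>t. dz (\<lambda>y. H_integrand r w C \<nu> N y t) z) \<and>
        (H ti tf r w C \<nu> N has_vector_derivative
          (LINT t:einterval ti tf|lebesgue. dz (\<lambda>y. H_integrand r w C \<nu> N y t) z)) (at z) \<and>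
        set_integrable lebesgue (einterval ti tf)
          (\<lambda>t. dz (dz (\<lambda>y. H_integrand r w C \<nu> N y t)) z) \<and>
        (dz (H ti tf r w C \<nu> N) has_vector_derivative
          (LINT t:einterval ti tf|lebesgue. dz (dz (\<lambda>y. H_integrand r w C \<nu> N y t)) z)) (at z))"

end

theory Submission
  imports Defs
begin

text \<open>
  For fixed \<open>t\<close> the integrand of \<open>H\<close> is, up to a factor independent of \<open>z\<close>, the rescaled function
  \<open>z \<mapsto> C \<nu> (z * \<rho>)\<close> with \<open>\<rho> = r t\<close>. The combination \<open>z\<^sup>2 d\<^sup>2/dz\<^sup>2 + z d/dz\<close> is invariant under such a
  rescaling of \<open>z\<close>, whereas the term \<open>z\<^sup>2\<close> on the right of the Bessel equation becomes \<open>\<rho>\<^sup>2 z\<^sup>2\<close>.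
  After division by \<open>z\<^sup>2\<close> the Bessel operator in \<open>z\<close> therefore multiplies the integrand by
  \<open>\<rho>\<^sup>2\<close>, up to sign, that is, it raises the exponent \<open>N\<close> to \<open>N + 2\<close> (\<open>bessel_operator_H_integrand\<close>).
  Since differentiation commutes with the integral, integrating this pointwise identity over
  \<open>t\<close> gives the claim.

  Both equations are instances of \<open>z\<^sup>2 f'' + z f' = (\<nu>\<^sup>2 - s z\<^sup>2) f\<close>, with \<open>s = 1\<close> for the Bessel
  equation and \<open>s = -1\<close> for the modified one, so that a single argument with a parameter \<open>s\<close>
  serves for both signs.
\<close>

lemma has_vector_derivative_rescale:
  fixes f :: "real \<Rightarrow> complex" and a b :: complex
  assumes "f differentiable (at (z * \<rho>))"
  shows "((\<lambda>y. a * f (y * \<rho>) * b) has_vector_derivative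
           (a * of_real \<rho>) * dz f (z * \<rho>) * b) (at z)"
proof -
  have "(f has_vector_derivative dz f (z * \<rho>)) (at (z * \<rho>))"
    using assms by (simp add: vector_derivative_works)
  moreover have "((\<lambda>y. y * \<rho>) has_vector_derivative \<rho>) (at z)"
    by (auto intro!: derivative_eq_intros simp: has_real_derivative_iff_has_vector_derivative[symmetric])
  ultimately have "((\<lambda>y. f (y * \<rho>)) has_vector_derivative \<rho> *\<^sub>R dz f (z * \<rho>)) (at z)"
    using vector_diff_chain_at[of "\<lambda>y. y * \<rho>" \<rho> z f] by (simp add: o_def)
  then have "((\<lambda>y. a * f (y * \<rho>) * b) has_vector_derivative a * (\<rho> *\<^sub>R dz f (z * \<rho>)) * b) (at z)"
    by (intro has_vector_derivative_mult_left has_vector_derivative_mult_right)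
  then show ?thesis
    by (simp add: scaleR_conv_of_real mult.assoc)
qed

lemma dz_rescale:
  fixes f :: "real \<Rightarrow> complex" and a b :: complex
  assumes "f differentiable (at (z * \<rho>))"
  shows "dz (\<lambda>y. a * f (y * \<rho>) * b) z = (a * of_real \<rho>) * dz f (z * \<rho>) * b"
  by (rule vector_derivative_at) (rule has_vector_derivative_rescale[OF assms])

lemma dz_dz_rescale:
  fixes f :: "real \<Rightarrow> complex" and a b :: complex
  assumes f: "\<And>x. x > 0 \<Longrightarrow> f differentiable (at x)"
    and f': "dz f differentiable (at (z * \<rho>))"
    and "z > 0" "\<rho> > 0"
  shows "dz (dz (\<lambda>y. a * f (y * \<rho>) * b)) z = (a * (of_real \<rho>)\<^sup>2) * dz (dz f) (z * \<rho>) * b"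
proof -
  \<comment> \<open>The formula for the first derivative is known only on the positive axis. That axis is
    open, so this determines the second derivative at \<open>z\<close>.\<close>
  have "(dz (\<lambda>y. a * f (y * \<rho>) * b) has_vector_derivative
          (a * of_real \<rho> * of_real \<rho>) * dz (dz f) (z * \<rho>) * b) (at z)"
  proof (rule has_vector_derivative_transform_within_open[where S = "{0<..}"])
    show "((\<lambda>y. (a * of_real \<rho>) * dz f (y * \<rho>) * b) has_vector_derivative
             (a * of_real \<rho> * of_real \<rho>) * dz (dz f) (z * \<rho>) * b) (at z)"
      by (rule has_vector_derivative_rescale[OF f'])
    show "(a * of_real \<rho>) * dz f (y * \<rho>) * b = dz (\<lambda>y. a * f (y * \<rho>) * b) y"
      if "y \<in> {0<..}" for y
      using that \<open>\<rho> > 0\<close> by (intro dz_rescale[symmetric] f) simp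
  qed (use \<open>z > 0\<close> in auto)
  then show ?thesis
    by (simp add: vector_derivative_at power2_eq_square mult.assoc)
qed

text \<open>
  With \<open>x = z * \<rho>\<close>, the chain rule turns \<open>z d/dz\<close> and \<open>z\<^sup>2 d\<^sup>2/dz\<^sup>2\<close> of the integrand into
  \<open>x dC/dx\<close> and \<open>x\<^sup>2 d\<^sup>2C/dx\<^sup>2\<close> times a common factor. The equation at \<open>x\<close> replaces their sum by
  \<open>(\<nu>\<^sup>2 - s x\<^sup>2) C\<close>; the \<open>\<nu>\<^sup>2\<close> term cancels and \<open>s x\<^sup>2 = s z\<^sup>2 \<rho>\<^sup>2\<close> leaves the weight \<open>\<rho>\<^sup>2\<close>.
\<close>

lemma bessel_operator_H_integrand:
  assumes C: "\<And>x. x > 0 \<Longrightarrow> C \<nu> differentiable (at x) \<and> dz (C \<nu>) differentiable (at x) \<and>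
        (of_real x)\<^sup>2 * dz (dz (C \<nu>)) x + of_real x * dz (C \<nu>) x =
          (\<nu>\<^sup>2 - s * (of_real x)\<^sup>2) * C \<nu> x"
    and z: "z > 0" and r: "r t > 0"
  shows "dz (dz (\<lambda>y. H_integrand r w C \<nu> N y t)) z
           + 1 / of_real z * dz (\<lambda>y. H_integrand r w C \<nu> N y t) z
           - \<nu>\<^sup>2 / (of_real z)\<^sup>2 * H_integrand r w C \<nu> N z t
         = - s * H_integrand r w C \<nu> (N + 2) z t"
proof -
  define \<rho> a x where "\<rho> = r t" and "a = complex_of_real (r t powr N)" and "x = z * \<rho>"
  have pos: "\<rho> > 0" "x > 0"
    using z r by (simp_all add: \<rho>_def x_def)
  have F: "(\<lambda>y. H_integrand r w C \<nu> N y t) = (\<lambda>y. a * C \<nu> (y * \<rho>) * w t)"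
    by (simp add: H_integrand_def a_def \<rho>_def)
  have F1: "dz (\<lambda>y. H_integrand r w C \<nu> N y t) z = (a * of_real \<rho>) * dz (C \<nu>) x * w t"
    unfolding F x_def using C[OF pos(2)] by (intro dz_rescale) (simp add: x_def)
  have F2: "dz (dz (\<lambda>y. H_integrand r w C \<nu> N y t)) z
              = (a * (of_real \<rho>)\<^sup>2) * dz (dz (C \<nu>)) x * w t"
    unfolding F x_def using C pos z by (intro dz_dz_rescale) (auto simp: x_def)
  have FN2: "H_integrand r w C \<nu> (N + 2) z t = a * (of_real \<rho>)\<^sup>2 * C \<nu> x * w t"
    using r by (simp add: H_integrand_def a_def \<rho>_def x_def powr_add)
  have z0: "complex_of_real z \<noteq> 0"
    using z by simp
  have eq: "(of_real z * of_real \<rho>)\<^sup>2 * dz (dz (C \<nu>)) x + of_real z * of_real \<rho> * dz (C \<nu>) x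
              = (\<nu>\<^sup>2 - s * (of_real z * of_real \<rho>)\<^sup>2) * C \<nu> x"
    using C[OF pos(2)] by (simp add: x_def)
  \<comment> \<open>Multiplying by \<open>z\<^sup>2\<close> clears the denominators and brings out the equation at \<open>x\<close>.\<close>
  have "(of_real z)\<^sup>2 * ((a * (of_real \<rho>)\<^sup>2) * dz (dz (C \<nu>)) x * w t
           + 1 / of_real z * ((a * of_real \<rho>) * dz (C \<nu>) x * w t)
           - \<nu>\<^sup>2 / (of_real z)\<^sup>2 * (a * C \<nu> x * w t))
        = a * w t * ((of_real z * of_real \<rho>)\<^sup>2 * dz (dz (C \<nu>)) x
             + of_real z * of_real \<rho> * dz (C \<nu>) x - \<nu>\<^sup>2 * C \<nu> x)"
    using z0 by (simp add: field_simps power2_eq_square)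
  also have "\<dots> = (of_real z)\<^sup>2 * (- s * (a * (of_real \<rho>)\<^sup>2 * C \<nu> x * w t))"
    unfolding eq by (simp add: algebra_simps power_mult_distrib)
  finally have "(a * (of_real \<rho>)\<^sup>2) * dz (dz (C \<nu>)) x * w t
           + 1 / of_real z * ((a * of_real \<rho>) * dz (C \<nu>) x * w t)
           - \<nu>\<^sup>2 / (of_real z)\<^sup>2 * (a * C \<nu> x * w t)
        = - s * (a * (of_real \<rho>)\<^sup>2 * C \<nu> x * w t)"
    using z0 by (subst (asm) mult_cancel_left) simp
  moreover have "H_integrand r w C \<nu> N z t = a * C \<nu> x * w t"
    by (simp add: H_integrand_def a_def \<rho>_def x_def)
  ultimately show ?thesis
    by (simp only: F1 F2 FN2)
qed

text \<open>
  The operator is linear with coefficients that do not depend on \<open>t\<close>, and all three terms are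
  absolutely integrable, so it passes through the integral and the pointwise identity applies.
\<close>

lemma bessel_operator_H:
  assumes C: "\<And>x. x > 0 \<Longrightarrow> C \<nu> differentiable (at x) \<and> dz (C \<nu>) differentiable (at x) \<and>
        (of_real x)\<^sup>2 * dz (dz (C \<nu>)) x + of_real x * dz (C \<nu>) x =
          (\<nu>\<^sup>2 - s * (of_real x)\<^sup>2) * C \<nu> x"
    and r: "\<And>t. t \<in> einterval ti tf \<Longrightarrow> r t > 0"
    and conv: "H_abs_convergent ti tf r w C \<nu> N"
    and diff: "H_diff_under_integral ti tf r w C \<nu> N"
    and z: "z > 0"
  shows "dz (dz (H ti tf r w C \<nu> N)) z + 1 / of_real z * dz (H ti tf r w C \<nu> N) z
           - \<nu>\<^sup>2 / (of_real z)\<^sup>2 * H ti tf r w C \<nu> N z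
         = - s * H ti tf r w C \<nu> (N + 2) z"
proof -
  let ?I = "einterval ti tf"
  let ?F = "\<lambda>t. H_integrand r w C \<nu> N z t"
  let ?F1 = "\<lambda>t. dz (\<lambda>y. H_integrand r w C \<nu> N y t) z"
  let ?F2 = "\<lambda>t. dz (dz (\<lambda>y. H_integrand r w C \<nu> N y t)) z"
  have int: "set_integrable lebesgue ?I ?F"
    using conv z by (simp add: H_abs_convergent_def)
  have int1: "set_integrable lebesgue ?I ?F1"
    and H1: "(H ti tf r w C \<nu> N has_vector_derivative (LINT t:?I|lebesgue. ?F1 t)) (at z)"
    and int2: "set_integrable lebesgue ?I ?F2"
    and H2: "(dz (H ti tf r w C \<nu> N) has_vector_derivative (LINT t:?I|lebesgue. ?F2 t)) (at z)"
    using diff z unfolding H_diff_under_integral_def by blast+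
  have meas: "?I \<in> sets lebesgue"
    by (simp add: borel_open)
  have "(LINT t:?I|lebesgue. ?F2 t + 1 / of_real z * ?F1 t - \<nu>\<^sup>2 / (of_real z)\<^sup>2 * ?F t)
      = (LINT t:?I|lebesgue. ?F2 t) + 1 / of_real z * (LINT t:?I|lebesgue. ?F1 t)
        - \<nu>\<^sup>2 / (of_real z)\<^sup>2 * (LINT t:?I|lebesgue. ?F t)"
    using int int1 int2
    by (simp only: set_integral_add set_integral_diff set_integrable_mult_right
        set_integral_mult_right simp_thms)
  also have "\<dots> = dz (dz (H ti tf r w C \<nu> N)) z + 1 / of_real z * dz (H ti tf r w C \<nu> N) z
           - \<nu>\<^sup>2 / (of_real z)\<^sup>2 * H ti tf r w C \<nu> N z"
    by (simp only: vector_derivative_at[OF H1] vector_derivative_at[OF H2] H_def)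
  finally have "dz (dz (H ti tf r w C \<nu> N)) z + 1 / of_real z * dz (H ti tf r w C \<nu> N) z
           - \<nu>\<^sup>2 / (of_real z)\<^sup>2 * H ti tf r w C \<nu> N z
      = (LINT t:?I|lebesgue. ?F2 t + 1 / of_real z * ?F1 t - \<nu>\<^sup>2 / (of_real z)\<^sup>2 * ?F t)"
    by (rule sym)
  also have "\<dots> = (LINT t:?I|lebesgue. - s * H_integrand r w C \<nu> (N + 2) z t)"
    by (intro set_lebesgue_integral_cong[OF meas] allI impI bessel_operator_H_integrand C z r)
  also have "\<dots> = - s * H ti tf r w C \<nu> (N + 2) z"
    by (simp only: set_integral_mult_right H_def)
  finally show ?thesis .
qed

theorem lemma3p1:
  fixes N :: real and \<nu> :: complex and ti tf :: ereal
    and r :: "real \<Rightarrow> real" and w :: "real \<Rightarrow> complex"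
    and C :: "complex \<Rightarrow> real \<Rightarrow> complex"
  assumes "ti < tf"
    and "\<And>t. t \<in> einterval ti tf \<Longrightarrow> r t > 0"
    and "H_abs_convergent ti tf r w C \<nu> N"
    and "H_abs_convergent ti tf r w C \<nu> (N + 2)"
    and "H_abs_convergent ti tf r w C (\<nu> + 1) (N + 1)"
    and "H_diff_under_integral ti tf r w C \<nu> N"
    and "\<And>z. z > 0 \<Longrightarrow>
      ((\<lambda>y. of_real y powr (- \<nu>) * C \<nu> y) has_vector_derivative
        - (of_real z powr (- \<nu>)) * C (\<nu> + 1) z) (at z)"
  shows "(bessel_equation \<nu> (C \<nu>) \<longrightarrow>
      (\<forall>z>0. H ti tf r w C \<nu> (N + 2) z =
        - (dz (dz (H ti tf r w C \<nu> N)) z + 1 / of_real z * dz (H ti tf r w C \<nu> N) z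
            - \<nu>\<^sup>2 / (of_real z)\<^sup>2 * H ti tf r w C \<nu> N z))) \<and>
    (modified_bessel_equation \<nu> (C \<nu>) \<longrightarrow>
      (\<forall>z>0. H ti tf r w C \<nu> (N + 2) z =
        dz (dz (H ti tf r w C \<nu> N)) z + 1 / of_real z * dz (H ti tf r w C \<nu> N) z
            - \<nu>\<^sup>2 / (of_real z)\<^sup>2 * H ti tf r w C \<nu> N z))"
proof -
  have "H ti tf r w C \<nu> (N + 2) z =
      - (dz (dz (H ti tf r w C \<nu> N)) z + 1 / of_real z * dz (H ti tf r w C \<nu> N) z
          - \<nu>\<^sup>2 / (of_real z)\<^sup>2 * H ti tf r w C \<nu> N z)"
    if "bessel_equation \<nu> (C \<nu>)" "z > 0" for z
    using that bessel_operator_H[where s = 1, OF _ assms(2,3,6), of z]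
    by (simp add: bessel_equation_def)
  moreover have "H ti tf r w C \<nu> (N + 2) z =
      dz (dz (H ti tf r w C \<nu> N)) z + 1 / of_real z * dz (H ti tf r w C \<nu> N) z
          - \<nu>\<^sup>2 / (of_real z)\<^sup>2 * H ti tf r w C \<nu> N z"
    if "modified_bessel_equation \<nu> (C \<nu>)" "z > 0" for z
    using that bessel_operator_H[where s = "-1", OF _ assms(2,3,6), of z]
    by (simp add: modified_bessel_equation_def)
  ultimately show ?thesis
    by blast
qed

end
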